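(* Let $r\ge 2$ and let $H$ be a connected $r$-uniform hypergraph on $n$ vertices with spectral radius $\rho$ and principal eigenvector $x$. For $u,v\in V(H)$, if $d(u,v)=\ell$, then $$\frac{1}{\rho^{\ell}}\le\frac{x_u}{x_v}\le \rho^{\ell}.$$
   Context: A hypergraph $H=(V(H),E(H))$ on $n$ vertices has vertex set $V(H)=[n]=\{1,\dots,n\}$ (after labelling) and a set $E(H)$ of edges, which are subsets of $V(H)$; it is $r$-uniform if every edge contains exactly $r$ vertices. A path is an alternating sequence $v_1e_1v_2e_2\cdots v_\ell e_\ell v_{\ell+1}$ with $v_i,v_{i+1}\in e_i$ for $1\le i\le \ell$, all vertices and all edges in it being distinct; its length is the number $\ell$ of its edges. $H$ is connected if any two vertices are joined by a path, and the distance $d(u,v)$ is the length of a shortest path connecting $u$ and $v$ (with $d(u,u)=0$). The adjacency tensor $\mathcal{A}(H)$ is the order $r$, dimension $n$ tensor whose $(i_1i_2\cdots i_r)$-entry is $\frac{1}{(r-1)!}$ if $\{i_1,\dots,i_r\}\in E(H)$ and $0$ otherwise. For an order $r$ dimension $n$ tensor $\mathcal{A}=(a_{i_1\cdots i_r})$ and $x\in\mathbb{C}^n$, $\mathcal{A}x$ is the vector in $\mathbb{C}^n$ with $(\mathcal{A}x)_i=\sum_{i_2,\dots,i_r=1}^n a_{ii_2\cdots i_r}x_{i_2}\cdots x_{i_r}$. A number $\lambda\in\mathbb{C}$ is an eigenvalue of $\mathcal{A}$ with eigenvector $x\neq 0$ if $(\mathcal{A}x)_i=\lambda x_i^{r-1}$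 for all $i$. The spectral radius $\rho(H)$ is the maximum modulus of the eigenvalues of $\mathcal{A}(H)$. For connected $H$, the principal eigenvector of $H$ is the unique eigenvector $x$ of $\mathcal{A}(H)$ corresponding to $\rho(H)$ with all entries positive and $\|x\|_r=\left(\sum_i x_i^r\right)^{1/r}=1$; $x_v$ denotes its entry at vertex $v$. *)

theory Defs
  imports "HOL-Analysis.Analysis"
begin

text \<open>
  A hypergraph is given by its edge set \<open>E :: 'n set set\<close>; its vertex set is the whole finite
  type \<open>'n\<close>, so that \<open>n = CARD('n)\<close> and vectors indexed by the vertices live in
  \<open>complex ^ 'n\<close>.
\<close>

definition r_uniform :: "nat \<Rightarrow> 'n::finite set set \<Rightarrow> bool" where
  "r_uniform r E \<longleftrightarrow> (\<forall>e\<in>E. card e = r)"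

text \<open>
  The path \<open>v\<^sub>1 e\<^sub>1 v\<^sub>2 \<dots> e\<^sub>l v\<^sub>l\<^sub>+\<^sub>1\<close> is encoded by the list \<open>vs\<close> of its vertices and the list \<open>es\<close>
  of its edges, both indexed from \<open>0\<close>. A single vertex is a path of length \<open>0\<close>.
\<close>

definition is_path :: "'n::finite set set \<Rightarrow> 'n list \<Rightarrow> 'n set list \<Rightarrow> bool" where
  "is_path E vs es \<longleftrightarrow>
     length vs = length es + 1 \<and> set es \<subseteq> E \<and> distinct vs \<and> distinct es \<and>
     (\<forall>i < length es. vs ! i \<in> es ! i \<and> vs ! (i + 1) \<in> es ! i)"

definition path_between :: "'n::finite set set \<Rightarrow> 'n \<Rightarrow> 'n \<Rightarrow> nat \<Rightarrow> bool" where
  "path_between E u v l \<longleftrightarrow>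
     (\<exists>vs es. is_path E vs es \<and> hd vs = u \<and> last vs = v \<and> length es = l)"

definition hg_connected :: "'n::finite set set \<Rightarrow> bool" where
  "hg_connected E \<longleftrightarrow> (\<forall>u v. \<exists>l. path_between E u v l)"

definition hg_dist :: "'n::finite set set \<Rightarrow> 'n \<Rightarrow> 'n \<Rightarrow> nat" where
  "hg_dist E u v = (LEAST l. path_between E u v l)"

text \<open>
  A tensor of order \<open>r\<close> and dimension \<open>CARD('n)\<close> is a function on index lists, of which only the
  values at lists of length \<open>r\<close> are relevant.
\<close>

type_synonym 'n tensor = "'n list \<Rightarrow> complex"

definition tensor_apply :: "nat \<Rightarrow> 'n::finite tensor \<Rightarrow> complex ^ 'n \<Rightarrow> complex ^ 'n" where
  "tensor_apply r A x =
     (\<chi> i. \<Sum>js | length js = r - 1. A (i # js) * (\<Prod>k < r - 1. x $ (js ! k)))"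

definition tensor_eigenpair :: "nat \<Rightarrow> 'n::finite tensor \<Rightarrow> complex \<Rightarrow> complex ^ 'n \<Rightarrow> bool" where
  "tensor_eigenpair r A lam x \<longleftrightarrow>
     x \<noteq> 0 \<and> (\<forall>i. tensor_apply r A x $ i = lam * (x $ i) ^ (r - 1))"

definition tensor_eigenvalue :: "nat \<Rightarrow> 'n::finite tensor \<Rightarrow> complex \<Rightarrow> bool" where
  "tensor_eigenvalue r A lam \<longleftrightarrow> (\<exists>x. tensor_eigenpair r A lam x)"

definition adjacency_tensor :: "nat \<Rightarrow> 'n::finite set set \<Rightarrow> 'n tensor" where
  "adjacency_tensor r E = (\<lambda>is. if set is \<in> E then 1 / fact (r - 1) else 0)"

definition hg_spectral_radius :: "nat \<Rightarrow> 'n::finite set set \<Rightarrow> real" where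
  "hg_spectral_radius r E =
     (GREATEST t. \<exists>lam. tensor_eigenvalue r (adjacency_tensor r E) lam \<and> t = cmod lam)"

definition principal_eigenvector :: "nat \<Rightarrow> 'n::finite set set \<Rightarrow> real ^ 'n \<Rightarrow> bool" where
  "principal_eigenvector r E x \<longleftrightarrow>
     tensor_eigenpair r (adjacency_tensor r E)
       (complex_of_real (hg_spectral_radius r E)) (\<chi> i. complex_of_real (x $ i)) \<and>
     (\<forall>i. x $ i > 0) \<and>
     root r (\<Sum>i\<in>UNIV. (x $ i) ^ r) = 1"

end

theory Submission
  imports Defs "HOL-Combinatorics.Multiset_Permutations"
begin

text \<open>
  Write \<open>P\<close> for the product of the entries of \<open>x\<close> over an edge \<open>e\<close>. In the eigenvalue equation at a
  vertex \<open>t \<in> e\<close> all terms are nonnegative, and \<open>e\<close> alone contributes \<open>P / x\<^sub>t\<close>; so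
  \<open>P \<le> \<rho> x\<^sub>t\<^sup>r\<close> (\<open>edge_prod_le\<close>).

  For distinct \<open>u, w \<in> e\<close>, multiply these inequalities over the \<open>r - 1\<close> vertices \<open>t \<noteq> u\<close> of \<open>e\<close>,
  and once more over \<open>t = w\<close>. This gives \<open>P\<^sup>r \<le> \<rho>\<^sup>r x\<^sub>w\<^sup>r (P / x\<^sub>u)\<^sup>r\<close>, in which \<open>P\<close> cancels and leaves
  \<open>x\<^sub>u \<le> \<rho> x\<^sub>w\<close> (\<open>adjacent_le\<close>). Chaining the bound for adjacent vertices along a path of length \<open>l\<close>,
  in both directions, yields \<open>x\<^sub>u \<le> \<rho>\<^sup>l x\<^sub>v\<close> and \<open>x\<^sub>v \<le> \<rho>\<^sup>l x\<^sub>u\<close>.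
\<close>

lemma prod_nth_distinct:
  assumes "distinct js"
  shows "(\<Prod>k<length js. f (js ! k)) = prod f (set js)"
  using assms by (intro prod.reindex_bij_betw bij_betw_nth) auto

lemma Re_prod_of_real:
  "Re (\<Prod>k\<in>K. complex_of_real (f k)) = (\<Prod>k\<in>K. f k)"
  by (metis Re_complex_of_real of_real_prod)

text \<open>
  The index lists that enumerate \<open>e - {t}\<close> number \<open>(r - 1)!\<close>, which cancels the normalisation
  \<open>1 / (r - 1)!\<close> of the adjacency tensor: the edge \<open>e\<close> contributes its product exactly once.
\<close>

lemma edge_prod_le_tensor_apply:
  fixes E :: "'n::finite set set" and x :: "real ^ 'n"
  assumes e: "e \<in> E" "card e = r" "t \<in> e" and nonneg: "\<And>i. x $ i \<ge> 0"
  shows "(\<Prod>s\<in>e - {t}. x $ s)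
    \<le> Re (tensor_apply r (adjacency_tensor r E) (\<chi> i. complex_of_real (x $ i)) $ t)"
proof -
  define c where "c js = (if set (t # js) \<in> E then 1 / fact (r - 1) else (0::real))" for js
  let ?term = "\<lambda>js. c js * (\<Prod>k<r - 1. x $ (js ! k))"
  have card: "card (e - {t}) = r - 1"
    using e by simp
  have len: "length js = r - 1" if "js \<in> permutations_of_set (e - {t})" for js
    using that card by (metis permutations_of_setD distinct_card)
  have "(\<Prod>s\<in>e - {t}. x $ s)
      = (\<Sum>js\<in>permutations_of_set (e - {t}). (\<Prod>s\<in>e - {t}. x $ s) / fact (r - 1))"
    by (simp add: card)
  also have "\<dots> = (\<Sum>js\<in>permutations_of_set (e - {t}). ?term js)"
  proof (rule sum.cong[OF refl])
    fix js assume js: "js \<in> permutations_of_set (e - {t})"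
    have "set (t # js) = e"
      using permutations_of_setD(1)[OF js] e by auto
    then have "c js = 1 / fact (r - 1)"
      using e by (simp add: c_def)
    moreover have "(\<Prod>k<r - 1. x $ (js ! k)) = (\<Prod>s\<in>e - {t}. x $ s)"
      using prod_nth_distinct[of js "\<lambda>s. x $ s"] permutations_of_setD[OF js] len[OF js] by simp
    ultimately show "(\<Prod>s\<in>e - {t}. x $ s) / fact (r - 1) = ?term js"
      by simp
  qed
  also have "\<dots> \<le> (\<Sum>js | length js = r - 1. ?term js)"
  proof (rule sum_mono2)
    show "finite {js :: 'n list. length js = r - 1}"
      using finite_lists_length_eq[of "UNIV :: 'n set"] by simp
    show "permutations_of_set (e - {t}) \<subseteq> {js. length js = r - 1}"
      using len by blast
    show "0 \<le> ?term js" for js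
      using nonneg by (intro mult_nonneg_nonneg prod_nonneg) (auto simp: c_def)
  qed
  also have "\<dots> = Re (tensor_apply r (adjacency_tensor r E) (\<chi> i. complex_of_real (x $ i)) $ t)"
  proof -
    have "adjacency_tensor r E (t # js) = complex_of_real (c js)" for js
      by (simp add: adjacency_tensor_def c_def)
    then show ?thesis
      by (simp add: tensor_apply_def Re_prod_of_real)
  qed
  finally show ?thesis .
qed

lemma edge_prod_le:
  fixes E :: "'n::finite set set" and x :: "real ^ 'n"
  assumes eig: "tensor_eigenpair r (adjacency_tensor r E) (complex_of_real \<rho>)
      (\<chi> i. complex_of_real (x $ i))"
    and pos: "\<And>i. x $ i > 0"
    and e: "e \<in> E" "card e = r" "t \<in> e"
  shows "(\<Prod>s\<in>e. x $ s) \<le> \<rho> * (x $ t) ^ r"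
proof -
  have "(\<Prod>s\<in>e - {t}. x $ s)
      \<le> Re (tensor_apply r (adjacency_tensor r E) (\<chi> i. complex_of_real (x $ i)) $ t)"
    using e pos by (intro edge_prod_le_tensor_apply) (auto intro: less_imp_le)
  also have "\<dots> = Re (complex_of_real (\<rho> * (x $ t) ^ (r - 1)))"
    using eig by (simp add: tensor_eigenpair_def)
  finally have "(\<Prod>s\<in>e - {t}. x $ s) \<le> \<rho> * (x $ t) ^ (r - 1)"
    by (simp only: Re_complex_of_real)
  then have "x $ t * (\<Prod>s\<in>e - {t}. x $ s) \<le> x $ t * (\<rho> * (x $ t) ^ (r - 1))"
    using pos[of t] by (intro mult_left_mono) auto
  moreover have "(\<Prod>s\<in>e. x $ s) = x $ t * (\<Prod>s\<in>e - {t}. x $ s)"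
    using e by (intro prod.remove) auto
  moreover have "r > 0"
    using e card_gt_0_iff[of e] by auto
  then have "x $ t * (x $ t) ^ (r - 1) = (x $ t) ^ r"
    by (simp add: power_eq_if)
  ultimately show ?thesis
    by (simp add: mult.left_commute)
qed

lemma eigenvalue_pos:
  fixes E :: "'n::finite set set" and x :: "real ^ 'n"
  assumes "tensor_eigenpair r (adjacency_tensor r E) (complex_of_real \<rho>)
      (\<chi> i. complex_of_real (x $ i))"
    and pos: "\<And>i. x $ i > 0"
    and "e \<in> E" "card e = r" "t \<in> e"
  shows "\<rho> > 0"
proof -
  have "0 < (\<Prod>s\<in>e. x $ s)"
    using pos by (intro prod_pos) auto
  also have "\<dots> \<le> \<rho> * (x $ t) ^ r"
    using assms by (rule edge_prod_le)
  finally show ?thesis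
    using pos[of t] by (simp add: zero_less_mult_iff)
qed

text \<open>
  The inequality of \<open>edge_prod_le\<close> at \<open>w\<close> alone does not bound \<open>x\<^sub>u\<close>, since the other vertices of the
  edge may carry small entries. Using \<open>w\<close> twice makes the number of factors exactly \<open>r\<close>, so that the
  unknown product over the edge cancels.
\<close>

lemma adjacent_le:
  fixes E :: "'n::finite set set" and x :: "real ^ 'n"
  assumes eig: "tensor_eigenpair r (adjacency_tensor r E) (complex_of_real \<rho>)
      (\<chi> i. complex_of_real (x $ i))"
    and pos: "\<And>i. x $ i > 0"
    and e: "e \<in> E" "card e = r" "u \<in> e" "w \<in> e" and "u \<noteq> w"
  shows "x $ u \<le> \<rho> * x $ w"
proof -
  define P where "P = (\<Prod>s\<in>e. x $ s)"
  define Q where "Q = (\<Prod>s\<in>e - {u}. x $ s)"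
  have rho: "\<rho> > 0"
    using eigenvalue_pos[OF eig pos e(1,2,3)] .
  have P: "P > 0" and Q: "Q > 0"
    using pos by (auto simp: P_def Q_def intro: prod_pos)
  have PQ: "P = x $ u * Q"
    unfolding P_def Q_def using e by (intro prod.remove) auto
  have le: "P \<le> \<rho> * (x $ t) ^ r" if "t \<in> e" for t
    unfolding P_def using edge_prod_le[OF eig pos e(1,2) that] .
  have r: "r = Suc (card (e - {u}))"
    using e card_gt_0_iff[of e] by auto
  have "P ^ r = P * (\<Prod>t\<in>e - {u}. P)"
    by (subst r) simp
  also have "\<dots> \<le> (\<rho> * (x $ w) ^ r) * (\<Prod>t\<in>e - {u}. \<rho> * (x $ t) ^ r)"
    using P le e rho pos by (intro mult_mono prod_mono prod_nonneg) (auto intro: less_imp_le)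
  also have "\<dots> = \<rho> ^ Suc (card (e - {u})) * (x $ w) ^ r * Q ^ r"
    by (simp add: prod.distrib prod_power_distrib Q_def)
  also have "\<dots> = (\<rho> * x $ w * Q) ^ r"
    by (simp only: r[symmetric] power_mult_distrib)
  finally have "P \<le> \<rho> * x $ w * Q"
    using rho pos[of w] Q r by (intro power_le_imp_le_base[of P "card (e - {u})"]) auto
  then show ?thesis
    using Q by (simp add: PQ)
qed

text \<open>
  Only an edge forces \<open>\<rho> > 0\<close>, so a path of length \<open>0\<close> gives no sign for \<open>\<rho>\<close>. The positivity of the
  power holds in all cases, and it is what dividing by \<open>\<rho>\<^sup>l\<close> requires.
\<close>

lemma path_entries_le:
  fixes E :: "'n::finite set set" and x :: "real ^ 'n"
  assumes eig: "tensor_eigenpair r (adjacency_tensor r E) (complex_of_real \<rho>)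
      (\<chi> i. complex_of_real (x $ i))"
    and pos: "\<And>i. x $ i > 0"
    and unif: "r_uniform r E" and path: "is_path E vs es"
  shows "i \<le> length es \<Longrightarrow>
    \<rho> ^ i > 0 \<and> x $ (vs ! 0) \<le> \<rho> ^ i * x $ (vs ! i) \<and> x $ (vs ! i) \<le> \<rho> ^ i * x $ (vs ! 0)"
proof (induction i)
  case 0
  then show ?case by simp
next
  case (Suc i)
  let ?e = "es ! i" and ?a = "vs ! i" and ?b = "vs ! Suc i"
  have i: "i < length es"
    using Suc.prems by simp
  then have e: "?e \<in> E" "?a \<in> ?e" "?b \<in> ?e"
    using path by (auto simp: is_path_def)
  have card: "card ?e = r"
    using unif e by (simp add: r_uniform_def)
  have ne: "?a \<noteq> ?b"
    using path i by (auto simp: is_path_def nth_eq_iff_index_eq)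
  have rho: "\<rho> > 0"
    using eigenvalue_pos[OF eig pos e(1) card e(2)] .
  have ab: "x $ ?a \<le> \<rho> * x $ ?b" and ba: "x $ ?b \<le> \<rho> * x $ ?a"
    using adjacent_le[OF eig pos e(1) card] e ne by auto
  have IH: "x $ (vs ! 0) \<le> \<rho> ^ i * x $ ?a" "x $ ?a \<le> \<rho> ^ i * x $ (vs ! 0)"
    using Suc.IH i by auto
  have "x $ (vs ! 0) \<le> \<rho> ^ i * (\<rho> * x $ ?b)"
    using IH(1) ab rho by (meson mult_left_mono order_trans zero_le_power less_imp_le)
  moreover have "x $ ?b \<le> \<rho> * (\<rho> ^ i * x $ (vs ! 0))"
    using IH(2) ba rho by (meson mult_left_mono order_trans less_imp_le)
  ultimately show ?case
    using rho by (simp add: mult_ac)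
qed

theorem theorem3p3:
  fixes E :: "'n::finite set set" and r l :: nat and \<rho> :: real
    and x :: "real ^ 'n" and u v :: 'n
  assumes "r \<ge> 2"
    and "r_uniform r E"
    and "hg_connected E"
    and "\<rho> = hg_spectral_radius r E"
    and "principal_eigenvector r E x"
    and "hg_dist E u v = l"
  shows "1 / \<rho> ^ l \<le> x $ u / x $ v \<and> x $ u / x $ v \<le> \<rho> ^ l"
proof -
  have eig: "tensor_eigenpair r (adjacency_tensor r E) (complex_of_real \<rho>)
      (\<chi> i. complex_of_real (x $ i))" and pos: "\<And>i. x $ i > 0"
    using assms(4,5) by (auto simp: principal_eigenvector_def)
  have "\<exists>l. path_between E u v l"
    using assms(3) by (simp add: hg_connected_def)
  then have "path_between E u v (hg_dist E u v)"
    unfolding hg_dist_def by (rule LeastI_ex)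
  then obtain vs es where path: "is_path E vs es" and hd: "hd vs = u" and last: "last vs = v"
    and len: "length es = l"
    using assms(6) by (auto simp: path_between_def)
  have "length vs = Suc l"
    using path len by (simp add: is_path_def)
  then have "vs \<noteq> []" "length vs - 1 = l"
    by auto
  then have "vs ! 0 = u" "vs ! l = v"
    using hd last by (auto simp: hd_conv_nth last_conv_nth)
  then have "\<rho> ^ l > 0" "x $ u \<le> \<rho> ^ l * x $ v" "x $ v \<le> \<rho> ^ l * x $ u"
    using path_entries_le[OF eig pos assms(2) path, of l] len by auto
  then show ?thesis
    using pos[of u] pos[of v] by (simp add: field_simps)
qed

end
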